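(* Let $G$ and $H$ be two finite simple graphs on a common vertex set $V$ of size $n$ with $\deg_G(v)=\deg_H(v)$ for all $v\in V$, and with adjacency matrices $A$ and $B$. Suppose $G\cong_{GBLS}H$. Let $V=\bigsqcup_{i=1}^pV_i$ be the partition of $V$ by degree and $e_i$ the characteristic vector of $V_i$. Then there exists an orthogonal matrix $Q$ such that $Q^\top AQ=B$ and $Q^\top e_i=e_i$ for $i=1,\dots,p$. In particular, if $\widetilde W_A=[e_1,Ae_1,\dots,A^{n-1}e_1,\dots,e_p,Ae_p,\dots,A^{n-1}e_p]$ has full row rank, then $Q$ is unique and rational. Moreover, $d_n(\widetilde W_A)\,Q$ is an integral matrix, where $d_n(\widetilde W_A)$ is the last invariant factor of $\widetilde W_A$.
   Context: Smith normal form: every $n\times m$ integral matrix $M$ can be written $M=U\Sigma V$ with $U,V$ unimodular (integral, determinant $\pm1$) and $\Sigma$ diagonal with nonnegative diagonal entries $d_1\mid d_2\mid\cdots\mid d_{\min(n,m)}$; $d_{\min(n,m)}$ is the last invariant factor of $M$. Generalized block Laplacian spectrum: with $J_{i,j}=e_ie_j^\top$ ($1\le i,j\le p$), for a tuple $\mathbf A=(A_1,\dots,A_k)$ of $n\times n$ matrices and variables $\mathbf s$ put $W_{\mathbf A}(\mathbf s)=\sum_is_iA_i$ and $\phi_{\mathbf A}(\mathbf s;t)=\det(tI-W_{\mathbf A}(\mathbf s))$. $G\cong_{GBLS}H$ means $\phi_{\mathbf A}(\mathbf s;t)=\phi_{\mathbf B}(\mathbf s;t)$ identically, where $\mathbf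 A=(A,J_{1,1},J_{1,2},\dots,J_{p,p})$ and $\mathbf B=(B,J_{1,1},J_{1,2},\dots,J_{p,p})$. *)

theory Defs
  imports "Graph_Theory.Graph_Theory" "Jordan_Normal_Form.DL_Rank"
begin

text \<open>
  A finite simple graph is a \<open>pair_graph\<close>: a finite, loop-free, symmetric digraph without
  parallel arcs, so each undirected edge is a pair of opposite arcs and the degree of a vertex
  is its out-degree. The list \<open>vs\<close> below enumerates the vertices; it fixes the
  order of the rows and columns of matrices. All indices start at 0.
\<close>

definition adjacency_mat :: "'v list \<Rightarrow> 'v pair_pre_digraph \<Rightarrow> 'a::zero_neq_one mat" where
  "adjacency_mat vs G = mat (length vs) (length vs)
     (\<lambda>(i, j). if (vs ! i, vs ! j) \<in> parcs G then 1 else 0)"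

definition char_vec :: "'v list \<Rightarrow> 'v set \<Rightarrow> 'a::zero_neq_one vec" where
  "char_vec vs S = vec (length vs) (\<lambda>i. if vs ! i \<in> S then 1 else 0)"

definition degree_classes :: "'v pair_pre_digraph \<Rightarrow> 'v set set" where
  "degree_classes G =
     (\<lambda>u. {v \<in> pverts G. out_degree G v = out_degree G u}) ` pverts G"

definition outer_prod :: "'a::times vec \<Rightarrow> 'a vec \<Rightarrow> 'a mat" where
  "outer_prod u v = mat (dim_vec u) (dim_vec v) (\<lambda>(i, j). u $ i * v $ j)"

text \<open>The pencil \<open>W\<close> of a tuple of \<open>n \<times> n\<close> matrices, and \<open>\<phi>(s;t) = det (t I - W(s))\<close>.\<close>

definition pencil :: "nat \<Rightarrow> real mat list \<Rightarrow> (nat \<Rightarrow> real) \<Rightarrow> real mat" where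
  "pencil n As s = mat n n (\<lambda>ij. \<Sum>k<length As. s k * (As ! k) $$ ij)"

definition pencil_char :: "nat \<Rightarrow> real mat list \<Rightarrow> (nat \<Rightarrow> real) \<Rightarrow> real \<Rightarrow> real" where
  "pencil_char n As s t = det (t \<cdot>\<^sub>m 1\<^sub>m n - pencil n As s)"

definition block_tuple :: "real mat \<Rightarrow> real vec list \<Rightarrow> real mat list" where
  "block_tuple A es = A # [outer_prod u v. u \<leftarrow> es, v \<leftarrow> es]"

text \<open>
  Only the first \<open>length es ^ 2 + 1\<close> values of \<open>s\<close> matter. Over the infinite field of reals,
  equality for all values is equality as polynomials in the variables \<open>s\<close> and \<open>t\<close>.
\<close>

definition gbls_equiv :: "real vec list \<Rightarrow> real mat \<Rightarrow> real mat \<Rightarrow> bool" where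
  "gbls_equiv es A B \<longleftrightarrow>
     (\<forall>s t. pencil_char (dim_row A) (block_tuple A es) s t
          = pencil_char (dim_row B) (block_tuple B es) s t)"

text \<open>Unlike \<^const>\<open>orthogonal_mat\<close>, this requires the columns to have norm 1.\<close>

definition orthonormal_mat :: "nat \<Rightarrow> real mat \<Rightarrow> bool" where
  "orthonormal_mat n Q \<longleftrightarrow>
     Q \<in> carrier_mat n n \<and> transpose_mat Q * Q = 1\<^sub>m n \<and> Q * transpose_mat Q = 1\<^sub>m n"

definition ext_walk_mat :: "'a::comm_semiring_1 mat \<Rightarrow> 'a vec list \<Rightarrow> 'a mat" where
  "ext_walk_mat A es =
     mat_of_cols (dim_row A) [A ^\<^sub>m k *\<^sub>v e. e \<leftarrow> es, k \<leftarrow> [0..<dim_row A]]"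

definition full_row_rank :: "real mat \<Rightarrow> bool" where
  "full_row_rank M \<longleftrightarrow> vec_space.rank (dim_row M) M = dim_row M"

definition unimodular_mat :: "nat \<Rightarrow> int mat \<Rightarrow> bool" where
  "unimodular_mat n U \<longleftrightarrow> U \<in> carrier_mat n n \<and> (det U = 1 \<or> det U = -1)"

definition smith_form :: "int mat \<Rightarrow> bool" where
  "smith_form S \<longleftrightarrow> diagonal_mat S
     \<and> (\<forall>i < min (dim_row S) (dim_col S). S $$ (i, i) \<ge> 0)
     \<and> (\<forall>i. Suc i < min (dim_row S) (dim_col S) \<longrightarrow> S $$ (i, i) dvd S $$ (Suc i, Suc i))"

definition smith_decomposition :: "int mat \<Rightarrow> int mat \<Rightarrow> int mat \<Rightarrow> int mat \<Rightarrow> bool" where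
  "smith_decomposition M U S V \<longleftrightarrow>
     S \<in> carrier_mat (dim_row M) (dim_col M) \<and> smith_form S
     \<and> unimodular_mat (dim_row M) U \<and> unimodular_mat (dim_col M) V \<and> M = U * S * V"

text \<open>A relation, holding for no \<open>d\<close> if \<open>M\<close> has no rows or no columns.\<close>

definition last_invariant_factor :: "int mat \<Rightarrow> int \<Rightarrow> bool" where
  "last_invariant_factor M d \<longleftrightarrow> (let r = min (dim_row M) (dim_col M) in
     r > 0 \<and> (\<exists>U S V. smith_decomposition M U S V \<and> d = S $$ (r - 1, r - 1)))"

end

theory Submission
  imports Defs "Jordan_Normal_Form.Char_Poly"
begin

text \<open>
  For \<open>t\<close> outside the spectrum of \<open>A\<close>, \<open>det (t I - A - s e_i e_j\<^sup>T)\<close> vanishes iff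
  \<open>s e_j\<^sup>T R(t) e_i = 1\<close> for the resolvent \<open>R(t)\<close>, so \<open>\<phi>\<close> determines the characteristic
  polynomial of \<open>A\<close> and all functions \<open>e_j\<^sup>T R(t) e_i\<close>. Their residues are the inner products
  of the projections of the \<open>e_i\<close> to the eigenspaces of \<open>A\<close>. Once \<open>A\<close> and \<open>B\<close> are brought
  to the same diagonal form \<open>D\<close>, these projections therefore have the same Gram matrix for \<open>A\<close>
  and for \<open>B\<close>; a product of reflections in eigenvectors of \<open>D\<close>, hence commuting with \<open>D\<close>,
  maps one family to the other.

  Any such \<open>Q\<close> satisfies \<open>Q\<^sup>T W_A = W_B\<close> with integral walk matrices. If \<open>N\<close> is integral
  with \<open>W_A N = c I\<close>, then \<open>c Q\<^sup>T = W_B N\<close> is integral. For full row rank,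
  \<open>c = det (W_A W_A\<^sup>T)\<close> is nonzero and gives uniqueness and rationality; the Smith form provides
  such an \<open>N\<close> for \<open>c = d_n\<close>.
\<close>

section \<open>Real inner products and extensionality of matrices\<close>

lemma scalar_prod_minus_self_eq:
  fixes x y :: "real vec"
  assumes "x \<in> carrier_vec n" "y \<in> carrier_vec n"
  shows "(x - y) \<bullet> (x - y) = x \<bullet> x - 2 * (x \<bullet> y) + y \<bullet> y"
  using assms by (simp add: minus_scalar_prod_distrib[of _ n] scalar_prod_minus_distrib[of _ n]
      comm_scalar_prod[of y n x])

lemma scalar_prod_self_ge_0: "(v :: real vec) \<bullet> v \<ge> 0"
  by (auto simp: scalar_prod_def intro!: sum_nonneg)

lemma scalar_prod_self_eq_0_iff:
  fixes v :: "real vec"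
  assumes "v \<in> carrier_vec n"
  shows "v \<bullet> v = 0 \<longleftrightarrow> v = 0\<^sub>v n"
  using assms by (auto simp: scalar_prod_def sum_nonneg_eq_0_iff vec_eq_iff)

text \<open>Unit vectors extract the columns. Identities with outer products are checked through
  this rule, because on a vector an outer product reduces to a scalar multiple.\<close>

lemma eq_mat_mult_vecI:
  fixes A B :: "'a::comm_semiring_1 mat"
  assumes A: "A \<in> carrier_mat m n" and B: "B \<in> carrier_mat m n"
    and eq: "\<And>v. v \<in> carrier_vec n \<Longrightarrow> A *\<^sub>v v = B *\<^sub>v v"
  shows "A = B"
proof (rule mat_col_eqI)
  fix j assume "j < dim_col B"
  with B have j: "j < n" by simp
  have "M *\<^sub>v unit_vec n j = col M j" if "M \<in> carrier_mat m n" for M :: "'a mat"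
    using that j by (intro eq_vecI) auto
  from this[OF A] this[OF B] eq[of "unit_vec n j"] show "col A j = col B j" by simp
qed (use A B in auto)

section \<open>Reflections\<close>

text \<open>For \<open>u = 0\<close> the division by zero makes this the identity.\<close>

definition reflection_mat :: "nat \<Rightarrow> real vec \<Rightarrow> real mat" where
  "reflection_mat n u = 1\<^sub>m n - (2 / (u \<bullet> u)) \<cdot>\<^sub>m outer_prod u u"

lemma outer_prod_carrier [simp]:
  "u \<in> carrier_vec m \<Longrightarrow> v \<in> carrier_vec n \<Longrightarrow> outer_prod u v \<in> carrier_mat m n"
  by (simp add: outer_prod_def)

lemma outer_prod_mult_vec:
  fixes u v w :: "'a::comm_semiring_0 vec"
  assumes "u \<in> carrier_vec m" "v \<in> carrier_vec n" "w \<in> carrier_vec n"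
  shows "outer_prod u v *\<^sub>v w = (v \<bullet> w) \<cdot>\<^sub>v u"
  using assms by (intro eq_vecI) (auto simp: outer_prod_def scalar_prod_def sum_distrib_right
      sum_distrib_left ac_simps intro!: sum.cong)

lemma smult_mat_mult_vec:
  fixes A :: "'a::comm_semiring_0 mat"
  assumes "A \<in> carrier_mat m n" "v \<in> carrier_vec n"
  shows "(k \<cdot>\<^sub>m A) *\<^sub>v v = k \<cdot>\<^sub>v (A *\<^sub>v v)"
  using assms by (intro eq_vecI) (auto simp: scalar_prod_def sum_distrib_left ac_simps)

lemma reflection_mat_carrier [simp]:
  "u \<in> carrier_vec n \<Longrightarrow> reflection_mat n u \<in> carrier_mat n n"
  by (simp add: reflection_mat_def minus_carrier_mat)

lemma reflection_mat_mult_vec: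
  assumes "u \<in> carrier_vec n" "v \<in> carrier_vec n"
  shows "reflection_mat n u *\<^sub>v v = v - (2 * (u \<bullet> v) / (u \<bullet> u)) \<cdot>\<^sub>v u"
  using assms
  by (simp add: reflection_mat_def minus_mult_distrib_mat_vec[of _ n n] smult_mat_mult_vec[of _ n n]
      outer_prod_mult_vec[of _ n _ n] smult_smult_assoc)

lemma transpose_reflection_mat:
  "u \<in> carrier_vec n \<Longrightarrow> transpose_mat (reflection_mat n u) = reflection_mat n u"
  by (intro eq_matI) (auto simp: reflection_mat_def outer_prod_def)

lemma reflection_mat_involution:
  assumes u: "u \<in> carrier_vec n"
  shows "reflection_mat n u * reflection_mat n u = 1\<^sub>m n"
proof (rule eq_mat_mult_vecI)
  fix v :: "real vec" assume v: "v \<in> carrier_vec n"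
  \<comment> \<open>A reflection flips the sign of the inner product with \<open>u\<close>, so the
    second application adds back the multiple of \<open>u\<close> that the first one
    subtracts.\<close>
  let ?c = "2 * (u \<bullet> v) / (u \<bullet> u)"
  have "u \<bullet> (v - ?c \<cdot>\<^sub>v u) = u \<bullet> v - ?c * (u \<bullet> u)"
    using u v by (simp add: scalar_prod_minus_distrib[of _ n])
  also have "\<dots> = - (u \<bullet> v)"
    using u v by (cases "u \<bullet> u = 0") (auto simp: scalar_prod_self_eq_0_iff[OF u])
  finally have "u \<bullet> (v - ?c \<cdot>\<^sub>v u) = - (u \<bullet> v)" .
  then show "reflection_mat n u * reflection_mat n u *\<^sub>v v = 1\<^sub>m n *\<^sub>v v"
    using u v by (auto simp: assoc_mult_mat_vec[of _ n n _ n] reflection_mat_mult_vec)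
qed (use u in \<open>auto intro!: mult_carrier_mat[of _ n n]\<close>)

lemma orthonormal_reflection_mat: "u \<in> carrier_vec n \<Longrightarrow> orthonormal_mat n (reflection_mat n u)"
  by (simp add: orthonormal_mat_def transpose_reflection_mat reflection_mat_involution)

text \<open>Equal norms give \<open>2 * (u \<bullet> x) = u \<bullet> u\<close> for
  \<open>u = x - y\<close>, so the reflection of \<open>x\<close> subtracts exactly one copy of
  \<open>u\<close>. For \<open>x = y\<close> it is the identity.\<close>

lemma reflection_mat_swap:
  assumes x: "x \<in> carrier_vec n" and y: "y \<in> carrier_vec n" and eq: "x \<bullet> x = y \<bullet> y"
  shows "reflection_mat n (x - y) *\<^sub>v x = y"
proof (cases "x = y")
  case True
  then show ?thesis using y by (intro eq_vecI) (auto simp: reflection_mat_mult_vec simp del: index_mult_mat_vec)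
next
  case False
  let ?u = "x - y"
  have u: "?u \<in> carrier_vec n" using x y by simp
  have "?u \<noteq> 0\<^sub>v n" using False x y by (auto simp: vec_eq_iff)
  then have nz: "?u \<bullet> ?u \<noteq> 0" using scalar_prod_self_eq_0_iff[OF u] by simp
  have "2 * (?u \<bullet> x) = ?u \<bullet> ?u"
    using x y eq by (simp add: scalar_prod_minus_self_eq[OF x y] minus_scalar_prod_distrib[of _ n]
        comm_scalar_prod[of y n x])
  with nz have "2 * (?u \<bullet> x) / (?u \<bullet> ?u) = 1" by simp
  then have "reflection_mat n ?u *\<^sub>v x = x - 1 \<cdot>\<^sub>v ?u"
    using reflection_mat_mult_vec[OF u x] by simp
  also have "\<dots> = y" using x y by (intro eq_vecI) auto
  finally show ?thesis .
qed

lemma symmetric_mat_scalar_prod: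
  fixes B :: "'a::comm_semiring_0 mat"
  assumes "B \<in> carrier_mat n n" "transpose_mat B = B" "u \<in> carrier_vec n" "v \<in> carrier_vec n"
  shows "u \<bullet> (B *\<^sub>v v) = (B *\<^sub>v u) \<bullet> v"
  using transpose_vec_mult_scalar[of B n n v u] assms by simp

text \<open>Moving \<open>B\<close> across the inner product turns
  \<open>u \<bullet> (B *\<^sub>v v)\<close> into \<open>d * (u \<bullet> v)\<close>. Hence both
  composites subtract the same multiple of \<open>u\<close> from
  \<open>B *\<^sub>v v\<close>.\<close>

lemma reflection_mat_commute:
  assumes B: "B \<in> carrier_mat n n" and sym: "transpose_mat B = B"
    and u: "u \<in> carrier_vec n" and ev: "B *\<^sub>v u = d \<cdot>\<^sub>v u"
  shows "reflection_mat n u * B = B * reflection_mat n u"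
proof (rule eq_mat_mult_vecI)
  fix v :: "real vec" assume v: "v \<in> carrier_vec n"
  have "u \<bullet> (B *\<^sub>v v) = d * (u \<bullet> v)"
    using symmetric_mat_scalar_prod[OF B sym u v] u v ev by simp
  then have "reflection_mat n u *\<^sub>v (B *\<^sub>v v) = B *\<^sub>v v - (2 * (u \<bullet> v) / (u \<bullet> u)) \<cdot>\<^sub>v (d \<cdot>\<^sub>v u)"
    using u v B by (simp add: reflection_mat_mult_vec smult_smult_assoc mult_ac)
  also have "\<dots> = B *\<^sub>v (reflection_mat n u *\<^sub>v v)"
    using u v B ev by (simp add: reflection_mat_mult_vec mult_minus_distrib_mat_vec[of _ n n] mult_mat_vec)
  finally show "reflection_mat n u * B *\<^sub>v v = B * reflection_mat n u *\<^sub>v v"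
    using B u v by (simp add: assoc_mult_mat_vec[of _ n n _ n])
qed (use B u in \<open>auto intro!: mult_carrier_mat[of _ n n]\<close>)

section \<open>Orthonormal matrices and partial isometries\<close>

lemma orthonormal_mat_carrier: "orthonormal_mat n Q \<Longrightarrow> Q \<in> carrier_mat n n"
  by (simp add: orthonormal_mat_def)

lemma orthonormal_mat_one [simp]: "orthonormal_mat n (1\<^sub>m n)"
  by (simp add: orthonormal_mat_def)

lemma orthonormal_mat_transpose: "orthonormal_mat n Q \<Longrightarrow> orthonormal_mat n (transpose_mat Q)"
  by (simp add: orthonormal_mat_def)

lemma mat_mult_cancel_middle:
  fixes P :: "'a::comm_semiring_1 mat"
  assumes "P \<in> carrier_mat n n" "Q \<in> carrier_mat n n" "R \<in> carrier_mat n n" "S \<in> carrier_mat n n"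
    and "Q * R = 1\<^sub>m n"
  shows "P * Q * (R * S) = P * S"
proof -
  have "P * Q * (R * S) = P * (Q * (R * S))" using assms by (simp add: assoc_mult_mat[of _ n n _ n _ n])
  also have "Q * (R * S) = Q * R * S" using assms assoc_mult_mat[of Q n n R n S n] by simp
  finally show ?thesis using assms by simp
qed

lemma orthonormal_mat_mult:
  assumes P: "orthonormal_mat n P" and Q: "orthonormal_mat n Q"
  shows "orthonormal_mat n (P * Q)"
proof -
  have c: "P \<in> carrier_mat n n" "Q \<in> carrier_mat n n" using P Q by (auto simp: orthonormal_mat_def)
  have t: "transpose_mat (P * Q) = transpose_mat Q * transpose_mat P" using c by (rule transpose_mult)
  have "transpose_mat Q * transpose_mat P * (P * Q) = 1\<^sub>m n"
    using P Q c by (subst mat_mult_cancel_middle[where n = n]) (auto simp: orthonormal_mat_def)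
  moreover have "P * Q * (transpose_mat Q * transpose_mat P) = 1\<^sub>m n"
    using P Q c by (subst mat_mult_cancel_middle[where n = n]) (auto simp: orthonormal_mat_def)
  ultimately show ?thesis using c by (simp add: orthonormal_mat_def t)
qed

lemma orthonormal_mat_mult_vec_cancel:
  assumes Q: "orthonormal_mat n Q" and v: "v \<in> carrier_vec n"
  shows "transpose_mat Q *\<^sub>v (Q *\<^sub>v v) = v" "Q *\<^sub>v (transpose_mat Q *\<^sub>v v) = v"
  using assms assoc_mult_mat_vec[of "transpose_mat Q" n n Q n v]
    assoc_mult_mat_vec[of Q n n "transpose_mat Q" n v]
  by (auto simp: orthonormal_mat_def)

lemma orthonormal_mat_scalar_prod:
  assumes Q: "orthonormal_mat n Q" and "u \<in> carrier_vec n" "v \<in> carrier_vec n"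
  shows "(Q *\<^sub>v u) \<bullet> (Q *\<^sub>v v) = u \<bullet> v"
  using transpose_vec_mult_scalar[of Q n n u "Q *\<^sub>v v"] assms orthonormal_mat_mult_vec_cancel[OF Q]
    orthonormal_mat_carrier[OF Q] comm_scalar_prod[of _ n]
  by (metis mult_mat_vec_carrier)

text \<open>Reflections match one pair after the other; each one fixes the pairs already matched.\<close>

lemma commuting_isometry_extension:
  fixes x y :: "'i \<Rightarrow> real vec" and d :: "'i \<Rightarrow> real"
  assumes "finite I"
    and B: "B \<in> carrier_mat n n" "transpose_mat B = B"
    and x: "\<And>i. i \<in> I \<Longrightarrow> x i \<in> carrier_vec n" "\<And>i. i \<in> I \<Longrightarrow> B *\<^sub>v x i = d i \<cdot>\<^sub>v x i"
    and y: "\<And>i. i \<in> I \<Longrightarrow> y i \<in> carrier_vec n" "\<And>i. i \<in> I \<Longrightarrow> B *\<^sub>v y i = d i \<cdot>\<^sub>v y i"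
    and gram: "\<And>i j. i \<in> I \<Longrightarrow> j \<in> I \<Longrightarrow> x i \<bullet> x j = y i \<bullet> y j"
  shows "\<exists>Q. orthonormal_mat n Q \<and> Q * B = B * Q \<and> (\<forall>i\<in>I. Q *\<^sub>v x i = y i)"
  using assms(1) x y gram
proof (induction I rule: finite_induct)
  case empty
  then show ?case using B by (intro exI[of _ "1\<^sub>m n"]) auto
next
  case (insert k I)
  then obtain Q where Q: "orthonormal_mat n Q" and comm: "Q * B = B * Q"
    and Qx: "\<And>i. i \<in> I \<Longrightarrow> Q *\<^sub>v x i = y i"
    by auto
  have Qc: "Q \<in> carrier_mat n n" using Q by (rule orthonormal_mat_carrier)
  have xk: "x k \<in> carrier_vec n" "B *\<^sub>v x k = d k \<cdot>\<^sub>v x k"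
    and yk: "y k \<in> carrier_vec n" "B *\<^sub>v y k = d k \<cdot>\<^sub>v y k" using insert.prems by auto
  \<comment> \<open>The isometry \<open>Q\<close> from the induction sends \<open>x k\<close> to
    \<open>z\<close>, which need not be \<open>y k\<close>; a further reflection corrects
    this.\<close>
  define z where "z = Q *\<^sub>v x k"
  define u where "u = z - y k"
  have z: "z \<in> carrier_vec n" using Qc xk by (simp add: z_def)
  have u: "u \<in> carrier_vec n" using z yk by (simp add: u_def)
  have "B *\<^sub>v z = B * Q *\<^sub>v x k" using B Qc xk by (simp add: z_def assoc_mult_mat_vec[of _ n n _ n])
  also have "\<dots> = d k \<cdot>\<^sub>v z"
    using B Qc xk by (simp add: comm[symmetric] z_def mult_mat_vec)
  finally have Bz: "B *\<^sub>v z = d k \<cdot>\<^sub>v z" .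
  \<comment> \<open>Both \<open>z\<close> and \<open>y k\<close> satisfy the eigenvector equation
    for \<open>d k\<close>, hence so does their difference, and the reflection in it commutes with
    \<open>B\<close>.\<close>
  have Bu: "B *\<^sub>v u = d k \<cdot>\<^sub>v u"
    using B z yk by (auto simp: u_def mult_minus_distrib_mat_vec[of _ n n] Bz vec_eq_iff algebra_simps)
  define R where "R = reflection_mat n u"
  have R: "orthonormal_mat n R" "R \<in> carrier_mat n n" "R * B = B * R"
    using u B Bu by (auto simp: R_def orthonormal_reflection_mat reflection_mat_commute)
  have "z \<bullet> z = y k \<bullet> y k"
    using insert.prems(5)[of k k] orthonormal_mat_scalar_prod[OF Q xk(1) xk(1)] by (simp add: z_def)
  then have "R *\<^sub>v z = y k"
    using reflection_mat_swap[OF z yk(1)] by (simp add: R_def u_def)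
  \<comment> \<open>Since \<open>Q\<close> preserves inner products and the Gram matrices agree,
    \<open>z\<close> and \<open>y k\<close> have the same inner product with \<open>y i\<close>. So
    \<open>u\<close> is orthogonal to \<open>y i\<close>, which the reflection leaves fixed.\<close>
  moreover have "R *\<^sub>v y i = y i" if i: "i \<in> I" for i
  proof -
    have yi: "y i \<in> carrier_vec n" and xi: "x i \<in> carrier_vec n" using insert.prems i by auto
    have "z \<bullet> y i = x k \<bullet> x i"
      using orthonormal_mat_scalar_prod[OF Q xk(1) xi] Qx[OF i] by (simp add: z_def)
    then have "u \<bullet> y i = 0"
      using insert.prems(5)[of k i] i z yk yi by (simp add: u_def minus_scalar_prod_distrib[of _ n])
    then have "R *\<^sub>v y i = y i - 0 \<cdot>\<^sub>v u" using u yi by (simp add: R_def reflection_mat_mult_vec)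
    then show ?thesis using u yi by auto
  qed
  moreover have "R * Q * B = B * (R * Q)"
    using R Qc B comm assoc_mult_mat[of R n n Q n B n] assoc_mult_mat[of R n n B n Q n]
      assoc_mult_mat[of B n n R n Q n] by simp
  ultimately show ?case
    using R Qc Qx insert.prems Q
    by (intro exI[of _ "R * Q"]) (auto simp: orthonormal_mat_mult assoc_mult_mat_vec[of _ n n _ n] z_def)
qed

section \<open>Diagonalization of real symmetric matrices\<close>

text \<open>As the entries are real, the conjugate of an eigenvector for \<open>z\<close> is one for
  \<open>cnj z\<close>. Evaluating the bilinear form of the symmetric matrix on this pair in two
  ways gives \<open>z\<close> and \<open>cnj z\<close> times the same nonzero squared norm.\<close>

lemma symmetric_real_mat_eigenvalue_real:
  fixes A :: "real mat"
  assumes A: "A \<in> carrier_mat n n" and sym: "transpose_mat A = A"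
    and ev: "eigenvalue (map_mat complex_of_real A) z"
  shows "z \<in> \<real>"
proof -
  let ?A = "map_mat complex_of_real A"
  have Ac: "?A \<in> carrier_mat n n" and symc: "transpose_mat ?A = ?A"
    using A by (simp_all add: map_mat_transpose sym)
  from ev Ac obtain v where v: "v \<in> carrier_vec n" "v \<noteq> 0\<^sub>v n" and Av: "?A *\<^sub>v v = z \<cdot>\<^sub>v v"
    by (auto simp: eigenvalue_def eigenvector_def)
  let ?w = "conjugate v"
  have w: "?w \<in> carrier_vec n" using v by simp
  have Aw: "?A *\<^sub>v ?w = cnj z \<cdot>\<^sub>v ?w"
  proof (rule eq_vecI)
    fix i assume "i < dim_vec (cnj z \<cdot>\<^sub>v ?w)"
    with v have i: "i < n" by simp
    have "(?A *\<^sub>v ?w) $ i = cnj ((?A *\<^sub>v v) $ i)"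
      using i A v by (auto simp: scalar_prod_def)
    also have "\<dots> = (cnj z \<cdot>\<^sub>v ?w) $ i" using i v by (simp add: Av)
    finally show "(?A *\<^sub>v ?w) $ i = (cnj z \<cdot>\<^sub>v ?w) $ i" .
  qed (use A v in auto)
  have "cnj z * (v \<bullet> ?w) = v \<bullet> (?A *\<^sub>v ?w)" using v w by (simp add: Aw)
  also have "\<dots> = z * (v \<bullet> ?w)"
    using symmetric_mat_scalar_prod[OF Ac symc v(1) w] v w by (simp add: Av)
  finally have "cnj z = z" using v by (simp add: conjugate_square_eq_0_vec)
  then show ?thesis by (simp add: Reals_cnj_iff)
qed

text \<open>Over the complex numbers the polynomial splits. Its roots are eigenvalues and hence
  real, so the factorization descends along the injective map
  \<open>complex_of_real\<close>.\<close>

lemma symmetric_real_mat_char_poly_splits: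
  fixes A :: "real mat"
  assumes A: "A \<in> carrier_mat n n" and sym: "transpose_mat A = A"
  obtains as where "char_poly A = (\<Prod>a\<leftarrow>as. [:- a, 1:])"
proof -
  let ?A = "map_mat complex_of_real A"
  interpret rc: map_poly_inj_idom_hom complex_of_real ..
  have Ac: "?A \<in> carrier_mat n n" using A by simp
  from char_poly_factorized[OF Ac] obtain zs where zs: "char_poly ?A = (\<Prod>z\<leftarrow>zs. [:- z, 1:])"
    by blast
  have real: "complex_of_real (Re z) = z" if "z \<in> set zs" for z
  proof -
    have "poly (char_poly ?A) z = 0" using that by (auto simp: zs poly_prod_list prod_list_zero_iff)
    then have "eigenvalue ?A z" using eigenvalue_root_char_poly[OF Ac] by simp
    then show ?thesis using symmetric_real_mat_eigenvalue_real[OF A sym] by (simp add: of_real_Re)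
  qed
  have "map_poly complex_of_real (char_poly A) = (\<Prod>z\<leftarrow>zs. [:- z, 1:])"
    by (simp add: of_real_hom.char_poly_hom[OF A, symmetric] zs)
  also have "\<dots> = (\<Prod>z\<leftarrow>zs. map_poly complex_of_real [:- Re z, 1:])"
    using real by (intro arg_cong[of _ _ prod_list] map_cong) auto
  also have "\<dots> = map_poly complex_of_real (\<Prod>z\<leftarrow>zs. [:- Re z, 1:])"
    by (simp add: rc.hom_prod_list o_def)
  finally have "char_poly A = (\<Prod>a\<leftarrow>map Re zs. [:- a, 1:])" by (simp add: o_def)
  then show ?thesis by (rule that)
qed

text \<open>A single reflection exchanging two unit vectors replaces the completion of
  \<open>v\<close> to an orthonormal basis.\<close>

lemma orthonormal_mat_unit_vec:
  assumes v: "v \<in> carrier_vec n" "v \<bullet> v = 1" and "0 < n"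
  obtains Q where "orthonormal_mat n Q" "Q *\<^sub>v unit_vec n 0 = v"
proof -
  have "unit_vec n 0 \<bullet> unit_vec n 0 = v \<bullet> v" using assms by simp
  with reflection_mat_swap[of "unit_vec n 0" n v] v show ?thesis
    by (intro that[of "reflection_mat n (unit_vec n 0 - v)"]) (auto simp: orthonormal_reflection_mat)
qed

lemma orthonormal_mat_similar:
  assumes "orthonormal_mat n Q" "A \<in> carrier_mat n n"
  shows "similar_mat (transpose_mat Q * A * Q) A"
proof (rule similar_matI)
  show "{transpose_mat Q * A * Q, A, transpose_mat Q, Q} \<subseteq> carrier_mat n n"
    using assms by (auto simp: orthonormal_mat_def)
qed (use assms in \<open>auto simp: orthonormal_mat_def\<close>)

lemma orthonormal_mat_conj_mult:
  assumes "orthonormal_mat n P" "orthonormal_mat n Q" "A \<in> carrier_mat n n"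
  shows "transpose_mat (P * Q) * A * (P * Q) = transpose_mat Q * (transpose_mat P * A * P) * Q"
proof -
  have c: "P \<in> carrier_mat n n" "Q \<in> carrier_mat n n" using assms by (auto simp: orthonormal_mat_def)
  show ?thesis using assms(3) c
    by (simp add: transpose_mult[OF c] assoc_mult_mat[of _ n n _ n _ n] mult_carrier_mat[of _ n n _ n])
qed

lemma orthonormal_four_block_mat:
  assumes "orthonormal_mat n P"
  shows "orthonormal_mat (Suc n) (four_block_mat (1\<^sub>m 1) (0\<^sub>m 1 n) (0\<^sub>m n 1) P)"
proof -
  have P: "P \<in> carrier_mat n n" "transpose_mat P \<in> carrier_mat n n"
    using assms by (auto simp: orthonormal_mat_def)
  have t: "transpose_mat (four_block_mat (1\<^sub>m 1) (0\<^sub>m 1 n) (0\<^sub>m n 1) P)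
      = four_block_mat (1\<^sub>m 1) (0\<^sub>m 1 n) (0\<^sub>m n 1) (transpose_mat P)"
    using P by (subst transpose_four_block_mat[of _ 1 1 _ n _ n]) auto
  show ?thesis using assms P four_block_carrier_mat[of "1\<^sub>m 1" 1 1 P n n]
    by (auto simp: orthonormal_mat_def t mult_four_block_mat[of _ 1 1 _ n _ n _ _ 1 _ n] simp del: One_nat_def)
qed

text \<open>The eigenvector equation determines the first column, and symmetry then determines the
  first row.\<close>

lemma symmetric_mat_deflate:
  fixes A :: "'a::comm_ring_1 mat"
  assumes A: "A \<in> carrier_mat (Suc n) (Suc n)" and sym: "transpose_mat A = A"
    and ev: "A *\<^sub>v unit_vec (Suc n) 0 = a \<cdot>\<^sub>v unit_vec (Suc n) 0"
  obtains A' where "A' \<in> carrier_mat n n" "transpose_mat A' = A'"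
    "A = four_block_mat (mat 1 1 (\<lambda>_. a)) (0\<^sub>m 1 n) (0\<^sub>m n 1) A'"
proof -
  let ?A' = "mat n n (\<lambda>(i, j). A $$ (Suc i, Suc j))"
  have comm: "A $$ (i, j) = A $$ (j, i)" if "i < Suc n" "j < Suc n" for i j
    using arg_cong[OF sym, of "\<lambda>M. M $$ (j, i)"] that A by auto
  have col: "A $$ (i, 0) = (if i = 0 then a else 0)" if "i < Suc n" for i
    using arg_cong[OF ev, of "\<lambda>v. v $ i"] that A by auto
  have row: "A $$ (0, i) = (if i = 0 then a else 0)" if "i < Suc n" for i
    using comm[of i 0] col[of i] that by simp
  show ?thesis
  proof
    show "?A' \<in> carrier_mat n n" by simp
    show "transpose_mat ?A' = ?A'" by (rule eq_matI) (auto intro: comm)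
    show "A = four_block_mat (mat 1 1 (\<lambda>_. a)) (0\<^sub>m 1 n) (0\<^sub>m n 1) ?A'"
      using A by (intro eq_matI) (auto simp: row col)
  qed
qed

lemma char_poly_deflated:
  fixes A' :: "'a::idom mat"
  assumes "A' \<in> carrier_mat n n"
  shows "char_poly (four_block_mat (mat 1 1 (\<lambda>_. a)) (0\<^sub>m 1 n) (0\<^sub>m n 1) A') = [:- a, 1:] * char_poly A'"
proof -
  have "char_poly (mat 1 1 (\<lambda>_. a)) = [:- a, 1:]"
    by (subst char_poly_upper_triangular[of _ 1]) (auto simp: diag_mat_def)
  then show ?thesis using assms by (subst char_poly_four_block_zeros_col) auto
qed

text \<open>Induction on the list of roots: a unit eigenvector for the first root is moved to the
  first coordinate, which splits off a block of size one. The diagonal follows the order of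
  \<open>as\<close>, so two matrices with the same factorization get the same diagonal form.\<close>

lemma symmetric_real_mat_diagonalizable:
  fixes A :: "real mat"
  assumes "A \<in> carrier_mat n n" "transpose_mat A = A" "char_poly A = (\<Prod>a\<leftarrow>as. [:- a, 1:])"
  shows "\<exists>P. orthonormal_mat n P \<and> transpose_mat P * A * P = mat_diag n (\<lambda>i. as ! i)"
  using assms
proof (induction as arbitrary: n A)
  case Nil
  \<comment> \<open>The characteristic polynomial has degree \<open>n\<close> and is here the empty
    product.\<close>
  then have "n = 0" using degree_monic_char_poly[OF Nil(1)] by simp
  with Nil show ?case by (intro exI[of _ "1\<^sub>m 0"]) (auto simp: mat_diag_def intro!: eq_matI)
next
  case (Cons a as)
  note A = Cons.prems(1) and sym = Cons.prems(2) and cp = Cons.prems(3)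
  have "eigenvalue A a" using eigenvalue_root_char_poly[OF A] cp by simp
  then obtain w where w: "w \<in> carrier_vec n" "w \<noteq> 0\<^sub>v n" and Aw: "A *\<^sub>v w = a \<cdot>\<^sub>v w"
    using A by (auto simp: eigenvalue_def eigenvector_def)
  obtain m where n: "n = Suc m" using w by (cases n) auto
  define v where "v = (1 / sqrt (w \<bullet> w)) \<cdot>\<^sub>v w"
  have "w \<bullet> w > 0"
    using scalar_prod_self_ge_0[of w] scalar_prod_self_eq_0_iff[OF w(1)] w(2) by simp
  then have v: "v \<in> carrier_vec n" "v \<bullet> v = 1" using w by (auto simp: v_def)
  have Av: "A *\<^sub>v v = a \<cdot>\<^sub>v v"
    using A w by (simp add: v_def mult_mat_vec[of _ n n] Aw smult_smult_assoc mult.commute)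
  obtain Q where Q: "orthonormal_mat n Q" and Qv: "Q *\<^sub>v unit_vec n 0 = v"
    using orthonormal_mat_unit_vec[OF v] n by blast
  have Qc: "Q \<in> carrier_mat n n" using Q by (rule orthonormal_mat_carrier)
  define A1 where "A1 = transpose_mat Q * A * Q"
  have A1: "A1 \<in> carrier_mat n n" using Qc A by (simp add: A1_def)
  have sym1: "transpose_mat A1 = A1"
    using Qc A by (simp add: A1_def transpose_mult[of _ n n _ n] sym assoc_mult_mat[of _ n n _ n _ n])
  have "A1 *\<^sub>v unit_vec n 0 = transpose_mat Q *\<^sub>v (A *\<^sub>v (Q *\<^sub>v unit_vec n 0))"
    using Qc A by (simp add: A1_def assoc_mult_mat_vec[of _ n n _ n])
  also have "\<dots> = a \<cdot>\<^sub>v (transpose_mat Q *\<^sub>v (Q *\<^sub>v unit_vec n 0))"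
    using Qc v by (simp add: Qv Av mult_mat_vec[of _ n n])
  also have "\<dots> = a \<cdot>\<^sub>v unit_vec n 0" using orthonormal_mat_mult_vec_cancel[OF Q] by simp
  finally obtain A' where A': "A' \<in> carrier_mat m m" "transpose_mat A' = A'"
    and A1_eq: "A1 = four_block_mat (mat 1 1 (\<lambda>_. a)) (0\<^sub>m 1 m) (0\<^sub>m m 1) A'"
    using symmetric_mat_deflate[of A1 m a] A1 sym1 n by blast
  have "char_poly A1 = char_poly A"
    unfolding A1_def by (rule char_poly_similar[OF orthonormal_mat_similar[OF Q A]])
  then have "[:- a, 1:] * char_poly A' = [:- a, 1:] * (\<Prod>a\<leftarrow>as. [:- a, 1:])"
    using cp unfolding A1_eq char_poly_deflated[OF A'(1)] by (simp only: list.map prod_list.Cons)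
  then have "char_poly A' = (\<Prod>a\<leftarrow>as. [:- a, 1:])"
    by (subst (asm) mult_left_cancel) auto
  from Cons.IH[OF A' this] obtain P where P: "orthonormal_mat m P"
    and PA: "transpose_mat P * A' * P = mat_diag m (\<lambda>i. as ! i)" by blast
  have Pc: "P \<in> carrier_mat m m" "transpose_mat P \<in> carrier_mat m m"
    using P by (auto simp: orthonormal_mat_def)
  \<comment> \<open>Bordering \<open>P\<close> by 1 fixes the first coordinate, so conjugation by
    \<open>R\<close> keeps the entry \<open>a\<close> and diagonalizes the block
    \<open>A'\<close>.\<close>
  define R where "R = four_block_mat (1\<^sub>m 1) (0\<^sub>m 1 m) (0\<^sub>m m 1) P"
  have R: "orthonormal_mat n R" unfolding R_def n by (rule orthonormal_four_block_mat[OF P])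
  have Rt: "transpose_mat R = four_block_mat (1\<^sub>m 1) (0\<^sub>m 1 m) (0\<^sub>m m 1) (transpose_mat P)"
    using Pc unfolding R_def by (subst transpose_four_block_mat[of _ 1 1 _ m _ m]) auto
  have "transpose_mat R * A1 * R
      = four_block_mat (mat 1 1 (\<lambda>_. a)) (0\<^sub>m 1 m) (0\<^sub>m m 1) (transpose_mat P * A' * P)"
    unfolding Rt A1_eq unfolding R_def using Pc A'
    by (simp add: mult_four_block_mat[of _ 1 1 _ m _ m _ _ 1 _ m] mult_carrier_mat[of _ m m _ m] del: One_nat_def)
  also have "\<dots> = mat_diag n (\<lambda>i. (a # as) ! i)"
    unfolding PA n by (rule eq_matI) (auto simp: mat_diag_def nth_Cons')
  finally show ?case
    using orthonormal_mat_mult[OF Q R] orthonormal_mat_conj_mult[OF Q R A] unfolding A1_def by metis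
qed

section \<open>Rank-one perturbations and residues\<close>

text \<open>A kernel vector \<open>v\<close> must have entries
  \<open>(y \<bullet> v) * x $ j / a j\<close>. Taking the inner product with \<open>y\<close> and
  cancelling \<open>y \<bullet> v\<close> yields the condition on the sum.\<close>

lemma det_diag_minus_outer_prod_eq_0_iff:
  fixes a :: "nat \<Rightarrow> real"
  assumes x: "x \<in> carrier_vec n" and y: "y \<in> carrier_vec n"
    and nz: "\<And>j. j < n \<Longrightarrow> a j \<noteq> 0"
  shows "det (mat_diag n a - outer_prod x y) = 0 \<longleftrightarrow> (\<Sum>j<n. x $ j * y $ j / a j) = 1"
proof -
  let ?M = "mat_diag n a - outer_prod x y"
  have M: "?M \<in> carrier_mat n n" using x y by (simp add: minus_carrier_mat)
  have Mv: "?M *\<^sub>v v = vec n (\<lambda>j. a j * v $ j - (y \<bullet> v) * x $ j)" if v: "v \<in> carrier_vec n" for v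
  proof -
    have "mat_diag n a *\<^sub>v v = vec n (\<lambda>j. a j * v $ j)"
      using v by (intro eq_vecI) (auto simp: mat_diag_def scalar_prod_def if_distrib[of "\<lambda>x. x * _"] cong: if_cong)
    then show ?thesis
      using minus_mult_distrib_mat_vec[of "mat_diag n a" n n "outer_prod x y" v] x y v
      by (auto simp: outer_prod_mult_vec[of _ n _ n])
  qed
  have "(\<exists>v. v \<in> carrier_vec n \<and> v \<noteq> 0\<^sub>v n \<and> ?M *\<^sub>v v = 0\<^sub>v n) \<longleftrightarrow>
      (\<Sum>j<n. x $ j * y $ j / a j) = 1"
  proof
    assume "\<exists>v. v \<in> carrier_vec n \<and> v \<noteq> 0\<^sub>v n \<and> ?M *\<^sub>v v = 0\<^sub>v n"
    then obtain v where v: "v \<in> carrier_vec n" "v \<noteq> 0\<^sub>v n" and "?M *\<^sub>v v = 0\<^sub>v n" by blast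
    then have "a j * v $ j - (y \<bullet> v) * x $ j = 0" if "j < n" for j
      using Mv[OF v(1)] that by (auto simp: vec_eq_iff)
    then have vj: "v $ j = (y \<bullet> v) * x $ j / a j" if "j < n" for j
      using nz[OF that] that by (simp add: field_simps)
    \<comment> \<open>Otherwise the formula for the entries would make \<open>v\<close>
      zero.\<close>
    have "y \<bullet> v \<noteq> 0" using v vj by (auto simp: vec_eq_iff)
    have "y \<bullet> v = (\<Sum>j<n. y $ j * v $ j)" using v by (auto simp: scalar_prod_def atLeast0LessThan)
    also have "\<dots> = (\<Sum>j<n. y $ j * ((y \<bullet> v) * x $ j / a j))"
      by (intro sum.cong refl) (use vj in simp)
    also have "\<dots> = (y \<bullet> v) * (\<Sum>j<n. x $ j * y $ j / a j)"
      by (simp add: sum_distrib_left mult_ac)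
    finally show "(\<Sum>j<n. x $ j * y $ j / a j) = 1" using \<open>y \<bullet> v \<noteq> 0\<close> by simp
  next
    assume sum: "(\<Sum>j<n. x $ j * y $ j / a j) = 1"
    \<comment> \<open>The kernel vector normalized so that its inner product with \<open>y\<close>
      is 1, which also shows that it is nonzero.\<close>
    define v where "v = vec n (\<lambda>j. x $ j / a j)"
    have v: "v \<in> carrier_vec n" by (simp add: v_def)
    have "y \<bullet> v = (\<Sum>j<n. x $ j * y $ j / a j)"
      by (auto simp: scalar_prod_def v_def atLeast0LessThan mult_ac)
    then have yv: "y \<bullet> v = 1" using sum by simp
    then have "v \<noteq> 0\<^sub>v n" using y by auto
    moreover have "?M *\<^sub>v v = 0\<^sub>v n"
      unfolding Mv[OF v] yv using nz by (intro eq_vecI) (auto simp: v_def)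
    ultimately show "\<exists>v. v \<in> carrier_vec n \<and> v \<noteq> 0\<^sub>v n \<and> ?M *\<^sub>v v = 0\<^sub>v n" using v by blast
  qed
  then show ?thesis by (simp add: det_0_iff_vec_prod_zero_field[OF M])
qed

text \<open>The determinant vanishes exactly when \<open>s\<close> times the sum is 1, so its zero
  in \<open>s\<close> is the reciprocal of the sum. A zero sum is recognized by the absence of such
  an \<open>s\<close>.\<close>

lemma resolvent_sum_eqI:
  fixes a :: "nat \<Rightarrow> real"
  assumes x: "x \<in> carrier_vec n" "x' \<in> carrier_vec n" and y: "y \<in> carrier_vec n" "y' \<in> carrier_vec n"
    and nz: "\<And>j. j < n \<Longrightarrow> a j \<noteq> 0"
    and det: "\<And>s. det (mat_diag n a - outer_prod (s \<cdot>\<^sub>v x) y) = det (mat_diag n a - outer_prod (s \<cdot>\<^sub>v x') y')"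
  shows "(\<Sum>j<n. x $ j * y $ j / a j) = (\<Sum>j<n. x' $ j * y' $ j / a j)" (is "?f = ?g")
proof -
  have *: "s * ?f = 1 \<longleftrightarrow> s * ?g = 1" for s
    using det[of s] det_diag_minus_outer_prod_eq_0_iff[of "s \<cdot>\<^sub>v x" n y a]
      det_diag_minus_outer_prod_eq_0_iff[of "s \<cdot>\<^sub>v x'" n y' a] x y nz
    by (simp add: sum_distrib_left mult_ac)
  show ?thesis
  proof (cases "?f = 0")
    case True
    then show ?thesis using *[of "1 / ?g"] by (cases "?g = 0") auto
  next
    case False
    then show ?thesis using *[of "1 / ?f"] by (simp add: field_simps)
  qed
qed

text \<open>Multiply by \<open>t - l\<close> and let \<open>t\<close> tend to \<open>l\<close>: the
  summands with \<open>d j = l\<close> tend to \<open>c j\<close>, all others to 0. Grouping by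
  value is essential because \<open>d\<close> may repeat.\<close>

lemma residue_sum_eq_0:
  fixes c d :: "'j \<Rightarrow> real"
  assumes J: "finite J" and zero: "\<And>t. t \<notin> d ` J \<Longrightarrow> (\<Sum>j\<in>J. c j / (t - d j)) = 0"
  shows "(\<Sum>j\<in>J. if d j = l then c j else 0) = 0"
proof -
  let ?f = "\<lambda>t. \<Sum>j\<in>J. (t - l) * (c j / (t - d j))"
  \<comment> \<open>The finitely many poles other than \<open>l\<close> form a closed set, so a
    punctured neighbourhood of \<open>l\<close> contains no pole.\<close>
  have ev: "\<forall>\<^sub>F t in at l. t \<notin> d ` J"
  proof -
    have "open (- (d ` J - {l}))" using J by (intro open_Compl finite_imp_closed) auto
    then have "\<forall>\<^sub>F t in at l. t \<in> - (d ` J - {l}) \<and> t \<noteq> l"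
      by (auto simp: eventually_at_topological)
    then show ?thesis by (rule eventually_mono) auto
  qed
  have "(?f \<longlongrightarrow> (\<Sum>j\<in>J. if d j = l then c j else 0)) (at l)"
  proof (rule tendsto_sum)
    fix j assume "j \<in> J"
    show "((\<lambda>t. (t - l) * (c j / (t - d j))) \<longlongrightarrow> (if d j = l then c j else 0)) (at l)"
    proof (cases "d j = l")
      case True
      have "\<forall>\<^sub>F t in at l. c j = (t - l) * (c j / (t - d j))"
        by (auto simp: True eventually_at_filter)
      then show ?thesis using True tendsto_cong by (auto intro: Lim_transform_eventually)
    next
      case False
      then have "((\<lambda>t. (t - l) * (c j / (t - d j))) \<longlongrightarrow> (l - l) * (c j / (l - d j))) (at l)"
        by (intro tendsto_intros) auto
      then show ?thesis using False by simp
    qed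
  qed
  moreover have "?f t = 0" if "t \<notin> d ` J" for t
    using zero[OF that] by (simp only: sum_distrib_left[symmetric] mult_zero_right)
  then have "\<forall>\<^sub>F t in at l. ?f t = 0" using ev by (rule eventually_mono[rotated])
  then have "(?f \<longlongrightarrow> 0) (at l)" by (rule tendsto_eventually)
  ultimately show ?thesis by (intro tendsto_unique) auto
qed

text \<open>The vector \<open>part l v\<close> is the projection of \<open>v\<close> to the
  eigenspace of \<open>l\<close>. The extension lemma is applied to all projections, indexed by
  pairs of an index and an eigenvalue; summing over the eigenvalues recovers the original
  vectors.\<close>

lemma diag_commuting_isometry:
  fixes x y :: "'i \<Rightarrow> real vec" and d :: "nat \<Rightarrow> real"
  assumes I: "finite I"
    and x: "\<And>i. i \<in> I \<Longrightarrow> x i \<in> carrier_vec n" and y: "\<And>i. i \<in> I \<Longrightarrow> y i \<in> carrier_vec n"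
    and res: "\<And>i k t. i \<in> I \<Longrightarrow> k \<in> I \<Longrightarrow> t \<notin> d ` {..<n} \<Longrightarrow>
      (\<Sum>j<n. x i $ j * x k $ j / (t - d j)) = (\<Sum>j<n. y i $ j * y k $ j / (t - d j))"
  shows "\<exists>Q. orthonormal_mat n Q \<and> Q * mat_diag n d = mat_diag n d * Q \<and> (\<forall>i\<in>I. Q *\<^sub>v x i = y i)"
proof -
  define part where "part l v = vec n (\<lambda>j. if d j = l then v $ j else 0)" for l and v :: "real vec"
  have part: "part l v \<in> carrier_vec n" for l v by (simp add: part_def)
  have ev: "mat_diag n d *\<^sub>v part l v = l \<cdot>\<^sub>v part l v" for l v
    by (intro eq_vecI) (auto simp: part_def mat_diag_def scalar_prod_def
        if_distrib[of "\<lambda>x. x * _"] cong: if_cong)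
  have sp: "part l u \<bullet> part m v = (if l = m then \<Sum>j<n. if d j = l then u $ j * v $ j else 0 else 0)"
    for l m u v
    by (auto simp: part_def scalar_prod_def atLeast0LessThan intro!: sum.cong sum.neutral)
  \<comment> \<open>For \<open>l = m\<close> these inner products are residues, and the residue
    lemma is applied to the difference of the two sums. For distinct eigenvalues the supports are
    disjoint and both sides vanish.\<close>
  have gram: "part l (x i) \<bullet> part m (x k) = part l (y i) \<bullet> part m (y k)" if ik: "i \<in> I" "k \<in> I" for l m i k
  proof -
    have "(\<Sum>j<n. if d j = l then x i $ j * x k $ j - y i $ j * y k $ j else 0) = 0"
      using res[OF ik] by (intro residue_sum_eq_0) (auto simp: diff_divide_distrib sum_subtractf)
    also have "(\<Sum>j<n. if d j = l then x i $ j * x k $ j - y i $ j * y k $ j else 0)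
        = (\<Sum>j<n. if d j = l then x i $ j * x k $ j else 0)
          - (\<Sum>j<n. if d j = l then y i $ j * y k $ j else 0)"
      by (subst sum_subtractf[symmetric]) (auto intro!: sum.cong)
    finally show ?thesis by (cases "l = m") (simp_all add: sp)
  qed
  have "transpose_mat (mat_diag n d) = mat_diag n d" by (rule eq_matI) (auto simp: mat_diag_def)
  then have "\<exists>Q. orthonormal_mat n Q \<and> Q * mat_diag n d = mat_diag n d * Q \<and>
      (\<forall>i\<in>I. \<forall>l\<in>d ` {..<n}. Q *\<^sub>v part l (x i) = part l (y i))"
    using commuting_isometry_extension[of "I \<times> d ` {..<n}" "mat_diag n d" n
        "\<lambda>(i, l). part l (x i)" snd "\<lambda>(i, l). part l (y i)"] I
    by (auto simp: part ev gram)
  then obtain Q where Q: "orthonormal_mat n Q" "Q * mat_diag n d = mat_diag n d * Q"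
    and Qp: "\<And>i l. i \<in> I \<Longrightarrow> l \<in> d ` {..<n} \<Longrightarrow> Q *\<^sub>v part l (x i) = part l (y i)"
    by blast
  have Qc: "Q \<in> carrier_mat n n" using Q(1) by (rule orthonormal_mat_carrier)
  have split: "v $ j = (\<Sum>l\<in>d ` {..<n}. part l v $ j)" if "j < n" for v j
    using that by (simp add: part_def)
  have "Q *\<^sub>v x i = y i" if i: "i \<in> I" for i
  proof (rule eq_vecI)
    fix r assume "r < dim_vec (y i)"
    with y[OF i] have r: "r < n" by simp
    have "(Q *\<^sub>v x i) $ r = (\<Sum>j<n. Q $$ (r, j) * (\<Sum>l\<in>d ` {..<n}. part l (x i) $ j))"
      using r Qc x[OF i] by (auto simp: scalar_prod_def atLeast0LessThan split[symmetric])
    also have "\<dots> = (\<Sum>l\<in>d ` {..<n}. \<Sum>j<n. Q $$ (r, j) * part l (x i) $ j)"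
      unfolding sum_distrib_left by (rule sum.swap)
    also have "\<dots> = (\<Sum>l\<in>d ` {..<n}. (Q *\<^sub>v part l (x i)) $ r)"
      using r Qc part by (auto simp: scalar_prod_def atLeast0LessThan part_def)
    also have "\<dots> = y i $ r" using r i by (simp add: Qp split[of r "y i"])
    finally show "(Q *\<^sub>v x i) $ r = y i $ r" .
  qed (use Qc y[OF i] in auto)
  with Q show ?thesis by blast
qed

section \<open>From the generalized block Laplacian spectrum to an orthogonal similarity\<close>

lemma outer_prod_conj:
  fixes P :: "real mat"
  assumes P: "P \<in> carrier_mat n n" and u: "u \<in> carrier_vec n" and v: "v \<in> carrier_vec n"
  shows "transpose_mat P * outer_prod u v * P = outer_prod (transpose_mat P *\<^sub>v u) (transpose_mat P *\<^sub>v v)"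
proof (rule eq_mat_mult_vecI)
  fix w :: "real vec" assume w: "w \<in> carrier_vec n"
  show "transpose_mat P * outer_prod u v * P *\<^sub>v w
      = outer_prod (transpose_mat P *\<^sub>v u) (transpose_mat P *\<^sub>v v) *\<^sub>v w"
    using assms w transpose_vec_mult_scalar[OF P w v]
    by (simp add: assoc_mult_mat_vec[of _ n n _ n] mult_carrier_mat[of _ n n _ n]
        outer_prod_mult_vec[of _ n _ n] mult_mat_vec[of _ n n])
qed (use assms in \<open>auto intro!: mult_carrier_mat[of _ n n]\<close>)

text \<open>Conjugation by \<open>P\<close> preserves the determinant, diagonalizes
  \<open>A\<close>, and replaces \<open>u\<close> and \<open>v\<close> by their coordinates in the
  eigenbasis.\<close>

lemma det_rank_one_perturbation:
  fixes A :: "real mat"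
  assumes A: "A \<in> carrier_mat n n" and P: "orthonormal_mat n P"
    and D: "transpose_mat P * A * P = mat_diag n d"
    and u: "u \<in> carrier_vec n" and v: "v \<in> carrier_vec n"
  shows "det (t \<cdot>\<^sub>m 1\<^sub>m n - (A + s \<cdot>\<^sub>m outer_prod u v))
    = det (mat_diag n (\<lambda>j. t - d j) - outer_prod (s \<cdot>\<^sub>v (transpose_mat P *\<^sub>v u)) (transpose_mat P *\<^sub>v v))"
proof -
  have Pc: "P \<in> carrier_mat n n" using P by (rule orthonormal_mat_carrier)
  let ?M = "t \<cdot>\<^sub>m 1\<^sub>m n - (A + s \<cdot>\<^sub>m outer_prod u v)"
  have M: "?M \<in> carrier_mat n n" using A u v by (auto intro!: minus_carrier_mat)
  have "transpose_mat P * ?M * P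
      = t \<cdot>\<^sub>m (transpose_mat P * P) - (transpose_mat P * A * P + s \<cdot>\<^sub>m (transpose_mat P * outer_prod u v * P))"
    using A Pc u v
    by (simp add: mult_minus_distrib_mat[of _ n n _ n] minus_mult_distrib_mat[of _ n n _ _ n]
        mult_add_distrib_mat[of _ n n _ n] add_mult_distrib_mat[of _ n n _ _ n]
        mult_smult_distrib[of _ n n _ n] mult_smult_assoc_mat[of _ n n _ n] mult_carrier_mat[of _ n n _ n]
        minus_carrier_mat)
  also have "\<dots> = t \<cdot>\<^sub>m 1\<^sub>m n - (mat_diag n d + s \<cdot>\<^sub>m outer_prod (transpose_mat P *\<^sub>v u) (transpose_mat P *\<^sub>v v))"
    using P by (simp add: D outer_prod_conj[OF Pc u v] orthonormal_mat_def)
  also have "\<dots> = mat_diag n (\<lambda>j. t - d j) - outer_prod (s \<cdot>\<^sub>v (transpose_mat P *\<^sub>v u)) (transpose_mat P *\<^sub>v v)"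
    using Pc u v by (intro eq_matI) (auto simp: outer_prod_def mat_diag_def)
  finally show ?thesis using det_similar[OF orthonormal_mat_similar[OF P M]] by simp
qed

text \<open>The values \<open>s\<close> are obtained before \<open>B\<close> is chosen, so that the
  same specialization serves both graphs.\<close>

lemma pencil_block_tuple_single:
  assumes es: "set es \<subseteq> carrier_vec n" and uv: "u \<in> set es" "v \<in> set es"
  obtains s where "\<And>B. B \<in> carrier_mat n n \<Longrightarrow>
    pencil n (block_tuple B es) s = B + c \<cdot>\<^sub>m outer_prod u v"
proof -
  let ?Ms = "concat (map (\<lambda>u. map (outer_prod u) es) es)"
  have "outer_prod u v \<in> set ?Ms" using uv by auto
  then obtain k where k: "k < length ?Ms" "?Ms ! k = outer_prod u v" by (metis in_set_conv_nth)
  \<comment> \<open>Position 0 of the tuple holds the matrix itself, which shifts the outer products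
    by one. Only position \<open>Suc k\<close> gets the weight \<open>c\<close>, even if the same
    outer product occurs elsewhere.\<close>
  define s where "s m = (if m = 0 then 1 else if m = Suc k then c else 0)" for m :: nat
  show ?thesis
  proof
    fix B :: "real mat" assume B: "B \<in> carrier_mat n n"
    have "(\<Sum>m<length (B # ?Ms). s m * ((B # ?Ms) ! m) $$ ij) = B $$ ij + c * outer_prod u v $$ ij" for ij
      using k unfolding length_Cons sum.lessThan_Suc_shift
      by (simp add: s_def if_distrib[of "\<lambda>x. x * _"] cong: if_cong)
    moreover have "outer_prod u v \<in> carrier_mat n n" using es uv by (intro outer_prod_carrier) auto
    ultimately show "pencil n (block_tuple B es) s = B + c \<cdot>\<^sub>m outer_prod u v"
      using B unfolding pencil_def block_tuple_def
      by (intro eq_matI) (simp_all del: length_concat length_map length_Cons)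
  qed
qed

lemma gbls_equiv_det:
  assumes A: "A \<in> carrier_mat n n" and B: "B \<in> carrier_mat n n" and gbls: "gbls_equiv es A B"
    and es: "set es \<subseteq> carrier_vec n" and uv: "u \<in> set es" "v \<in> set es"
  shows "det (t \<cdot>\<^sub>m 1\<^sub>m n - (A + s \<cdot>\<^sub>m outer_prod u v)) = det (t \<cdot>\<^sub>m 1\<^sub>m n - (B + s \<cdot>\<^sub>m outer_prod u v))"
proof -
  obtain f where "\<And>B. B \<in> carrier_mat n n \<Longrightarrow> pencil n (block_tuple B es) f = B + s \<cdot>\<^sub>m outer_prod u v"
    using pencil_block_tuple_single[OF es uv] by blast
  from this[OF A] this[OF B] show ?thesis
    using gbls A B by (simp add: gbls_equiv_def pencil_char_def) metis
qed

text \<open>Weight 1 on the first matrix and 0 on the others isolates it. This is separate from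
  \<open>gbls_equiv_det\<close>, which needs elements of \<open>es\<close>, whereas here
  \<open>es\<close> may be empty.\<close>

lemma gbls_equiv_char_poly:
  assumes A: "A \<in> carrier_mat n n" and B: "B \<in> carrier_mat n n" and gbls: "gbls_equiv es A B"
  shows "char_poly A = char_poly B"
proof -
  let ?s = "\<lambda>m::nat. if m = 0 then 1 else 0 :: real"
  have p: "pencil n (block_tuple M es) ?s = M" if "M \<in> carrier_mat n n" for M
    using that unfolding pencil_def block_tuple_def length_Cons sum.lessThan_Suc_shift
    by (intro eq_matI) auto
  have c: "poly (char_poly M) t = det (t \<cdot>\<^sub>m 1\<^sub>m n - M)" if M: "M \<in> carrier_mat n n" for M :: "real mat" and t
    unfolding char_poly_def using M
    by (intro poly_det_cong[of _ n]) (auto simp: char_poly_matrix_def minus_carrier_mat)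
  have "poly (char_poly A) = poly (char_poly B)"
    using gbls A B by (auto simp: gbls_equiv_def pencil_char_def c[OF A] c[OF B] fun_eq_iff
       dest!: spec[of _ ?s] simp: p)
  then show ?thesis by (simp add: poly_eq_poly_eq_iff)
qed

lemma gbls_equiv_imp_orthonormal_mat:
  assumes A: "A \<in> carrier_mat n n" "transpose_mat A = A" and B: "B \<in> carrier_mat n n" "transpose_mat B = B"
    and es: "set es \<subseteq> carrier_vec n" and gbls: "gbls_equiv es A B"
  shows "\<exists>Q. orthonormal_mat n Q \<and> transpose_mat Q * A * Q = B \<and> (\<forall>e\<in>set es. transpose_mat Q *\<^sub>v e = e)"
proof -
  from symmetric_real_mat_char_poly_splits[OF A] obtain as
    where as: "char_poly A = (\<Prod>a\<leftarrow>as. [:- a, 1:])" .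
  \<comment> \<open>The same list of roots serves both matrices, so \<open>P\<close> and
    \<open>R\<close> lead to one common diagonal matrix.\<close>
  define d where "d = (\<lambda>j. as ! j)"
  obtain P where P: "orthonormal_mat n P" and PA: "transpose_mat P * A * P = mat_diag n d"
    using symmetric_real_mat_diagonalizable[OF A as] by (auto simp: d_def)
  obtain R where R: "orthonormal_mat n R" and RB: "transpose_mat R * B * R = mat_diag n d"
    using symmetric_real_mat_diagonalizable[OF B] as gbls_equiv_char_poly[OF A(1) B(1) gbls]
    by (auto simp: d_def)
  have Pc: "P \<in> carrier_mat n n" and Rc: "R \<in> carrier_mat n n"
    using P R by (auto simp: orthonormal_mat_def)
  let ?x = "\<lambda>e. transpose_mat P *\<^sub>v e" and ?y = "\<lambda>e. transpose_mat R *\<^sub>v e"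
  have xyc: "?x e \<in> carrier_vec n" "?y e \<in> carrier_vec n" if "e \<in> set es" for e
    using that es Pc Rc by auto
  have res: "(\<Sum>j<n. ?x u $ j * ?x v $ j / (t - d j)) = (\<Sum>j<n. ?y u $ j * ?y v $ j / (t - d j))"
    if uv: "u \<in> set es" "v \<in> set es" and t: "t \<notin> d ` {..<n}" for u v t
  proof (rule resolvent_sum_eqI)
    fix s
    have uvc: "u \<in> carrier_vec n" "v \<in> carrier_vec n" using uv es by auto
    show "det (mat_diag n (\<lambda>j. t - d j) - outer_prod (s \<cdot>\<^sub>v ?x u) (?x v))
        = det (mat_diag n (\<lambda>j. t - d j) - outer_prod (s \<cdot>\<^sub>v ?y u) (?y v))"
      using gbls_equiv_det[OF A(1) B(1) gbls es uv]
      by (simp add: det_rank_one_perturbation[OF A(1) P PA uvc, symmetric]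
          det_rank_one_perturbation[OF B(1) R RB uvc, symmetric])
  qed (use t uv es Pc Rc in auto)
  then obtain S where S: "orthonormal_mat n S" and comm: "S * mat_diag n d = mat_diag n d * S"
    and Sx: "\<And>e. e \<in> set es \<Longrightarrow> S *\<^sub>v ?x e = ?y e"
    using diag_commuting_isometry[of "set es" ?x n ?y d, OF finite_set xyc res] by blast
  have Sc: "S \<in> carrier_mat n n" using S by (rule orthonormal_mat_carrier)
  note ortho = orthonormal_mat_transpose[OF S] orthonormal_mat_transpose[OF R]
  \<comment> \<open>With these choices \<open>transpose_mat Q\<close> is
    \<open>R * S * transpose_mat P\<close>: pass to eigencoordinates of \<open>A\<close>, match the
    vectors by \<open>S\<close>, and return through the eigenbasis of \<open>B\<close>.\<close>
  define T where "T = transpose_mat S * transpose_mat R"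
  define Q where "Q = P * T"
  have T: "orthonormal_mat n T" unfolding T_def by (intro orthonormal_mat_mult ortho)
  have Tt: "transpose_mat T = R * S" using Sc Rc by (simp add: T_def transpose_mult[of _ n n _ n])
  have Tc: "T \<in> carrier_mat n n" using T by (rule orthonormal_mat_carrier)
  have "S * mat_diag n d * transpose_mat S = mat_diag n d * (S * transpose_mat S)"
    using Sc by (simp add: comm assoc_mult_mat[of _ n n _ n _ n])
  also have "\<dots> = mat_diag n d" using S by (simp add: orthonormal_mat_def right_mult_one_mat[of _ n n])
  finally have SD: "S * mat_diag n d * transpose_mat S = mat_diag n d" .
  have "transpose_mat Q * A * Q = transpose_mat T * mat_diag n d * T"
    unfolding Q_def by (simp add: orthonormal_mat_conj_mult[OF P T A(1)] PA)
  also have "\<dots> = R * (S * mat_diag n d * transpose_mat S) * transpose_mat R"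
    using orthonormal_mat_conj_mult[OF ortho mat_diag_dim[of n d]] by (simp add: T_def)
  also have "\<dots> = R * (transpose_mat R * B * R) * transpose_mat R" by (simp add: SD RB)
  also have "\<dots> = B"
    using orthonormal_mat_conj_mult[OF R ortho(2) B(1)] R B(1)
    by (simp add: orthonormal_mat_def right_mult_one_mat[of _ n n])
  finally have QAQ: "transpose_mat Q * A * Q = B" .
  have "transpose_mat Q *\<^sub>v e = e" if e: "e \<in> set es" for e
  proof -
    have ec: "e \<in> carrier_vec n" using e es by auto
    have "transpose_mat Q *\<^sub>v e = R *\<^sub>v (S *\<^sub>v ?x e)"
      using Pc Tc Rc Sc ec
      by (simp add: Q_def transpose_mult[of _ n n _ n] Tt assoc_mult_mat_vec[of _ n n _ n]
          mult_carrier_mat[of _ n n _ n])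
    also have "\<dots> = e" by (simp add: Sx[OF e] orthonormal_mat_mult_vec_cancel[OF R ec])
    finally show ?thesis .
  qed
  with QAQ orthonormal_mat_mult[OF P T] show ?thesis unfolding Q_def by blast
qed

section \<open>Walk matrices and integrality\<close>

text \<open>A kernel vector of the Gram matrix is killed by \<open>transpose_mat M\<close>, since
  the squared norm of its image is 0. It is then orthogonal to every column, but full rank provides
  \<open>n\<close> independent columns.\<close>

lemma full_row_rank_imp_gram_nonsingular:
  fixes M :: "real mat"
  assumes M: "M \<in> carrier_mat n m" and rank: "full_row_rank M"
  shows "det (M * transpose_mat M) \<noteq> 0"
proof
  assume det: "det (M * transpose_mat M) = 0"
  interpret vec_space "TYPE(real)" n .
  have MM: "M * transpose_mat M \<in> carrier_mat n n" using M by (auto intro!: mult_carrier_mat[of _ n m])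
  from det obtain v where v: "v \<in> carrier_vec n" "v \<noteq> 0\<^sub>v n" and "M * transpose_mat M *\<^sub>v v = 0\<^sub>v n"
    by (auto simp: det_0_iff_vec_prod_zero_field[OF MM])
  then have z: "M *\<^sub>v (transpose_mat M *\<^sub>v v) = 0\<^sub>v n"
    using M by (simp add: assoc_mult_mat_vec[of _ n m _ n])
  have w: "transpose_mat M *\<^sub>v v \<in> carrier_vec m" using M v by (intro mult_mat_vec_carrier[of _ m n]) auto
  have "(transpose_mat M *\<^sub>v v) \<bullet> (transpose_mat M *\<^sub>v v) = 0"
    using transpose_vec_mult_scalar[OF M w v(1)] v by (simp add: z)
  then have Mv: "transpose_mat M *\<^sub>v v = 0\<^sub>v m" using scalar_prod_self_eq_0_iff[OF w] by simp
  have orth: "c \<bullet> v = 0" if c: "c \<in> set (cols M)" for c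
  proof -
    from c obtain j where j: "j < m" "c = col M j" using M by (auto simp: cols_def)
    show ?thesis using arg_cong[OF Mv, of "\<lambda>v. v $ j"] j M by simp
  qed
  \<comment> \<open>A maximal independent set of columns has as many elements as the rank, so
    listing it gives a nonsingular square matrix \<open>N\<close>.\<close>
  obtain S where S: "maximal S (\<lambda>T. T \<subseteq> set (cols M) \<and> lin_indpt T)"
    using maximal_exists_superset[of "set (cols M)" "\<lambda>T. T \<subseteq> set (cols M) \<and> lin_indpt T" "{}"]
    by (auto simp: lin_dep_def)
  have Sc: "S \<subseteq> set (cols M)" and li: "lin_indpt S" using S by (auto simp: maximal_def)
  have "rank M = n" using rank M by (simp add: full_row_rank_def)
  then have card: "card S = n" using rank_card_indpt[OF M S] by simp
  obtain ss where ss: "set ss = S" "distinct ss"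
    using finite_distinct_list[of S] Sc finite_subset by auto
  have len: "length ss = n" using ss card distinct_card by force
  define N where "N = mat_of_cols n ss"
  have N: "N \<in> carrier_mat n n" using len by (simp add: N_def carrier_matI)
  have ssc: "set ss \<subseteq> carrier_vec n" using ss Sc M cols_dim[of M] by auto
  have cN: "cols N = ss" using ssc by (simp add: N_def)
  have "rank N = n" using lin_indpt_full_rank[OF N] ss li by (simp add: cN)
  then have "det N \<noteq> 0" using det_rank_iff[OF N] by simp
  then have "det (transpose_mat N) \<noteq> 0" by (simp add: det_transpose[OF N])
  moreover have "transpose_mat N *\<^sub>v v = 0\<^sub>v n"
  proof (rule eq_vecI)
    fix i assume "i < dim_vec (0\<^sub>v n :: real vec)"
    then have i: "i < n" by simp
    have "col N i \<in> set (cols M)" using i N len Sc ss cN by (metis cols_nth carrier_matD(2) nth_mem subsetD)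
    then show "(transpose_mat N *\<^sub>v v) $ i = 0\<^sub>v n $ i" using i N orth by simp
  qed (use N in auto)
  ultimately show False
    using v N det_0_iff_vec_prod_zero_field[of "transpose_mat N" n] by auto
qed

section \<open>Smith form and integral right multiples\<close>

text \<open>The determinant is its own inverse, so the adjugate scaled by it is an integral
  inverse.\<close>

lemma unimodular_mat_inverse:
  assumes "unimodular_mat n U"
  obtains U' where "U' \<in> carrier_mat n n" "U * U' = 1\<^sub>m n" "U' * U = 1\<^sub>m n"
proof -
  have U: "U \<in> carrier_mat n n" and d: "det U * det U = 1"
    using assms by (auto simp: unimodular_mat_def)
  have "det U \<cdot>\<^sub>m (det U \<cdot>\<^sub>m 1\<^sub>m n) = 1\<^sub>m n"
    by (rule eq_matI) (auto simp: d)
  then have "U * (det U \<cdot>\<^sub>m adj_mat U) = 1\<^sub>m n" "(det U \<cdot>\<^sub>m adj_mat U) * U = 1\<^sub>m n"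
    using adj_mat[OF U] U
    by (auto simp: mult_smult_distrib[of _ n n _ n] mult_smult_assoc_mat[of _ n n _ n])
  then show ?thesis using adj_mat(1)[OF U] by (intro that[of "det U \<cdot>\<^sub>m adj_mat U"]) auto
qed

lemma smith_form_dvd:
  assumes "smith_form S" "j < min (dim_row S) (dim_col S)" "i \<le> j"
  shows "S $$ (i, i) dvd S $$ (j, j)"
  using assms(3,2)
proof (induction rule: dec_induct)
  case (step k)
  then show ?case using assms(1) by (auto simp: smith_form_def intro: dvd_trans)
qed simp

text \<open>The factor \<open>d\<close> clears the denominators \<open>d_i\<close> in a right inverse of the Smith form;
  where \<open>d_i = 0\<close> also \<open>d = 0\<close>, and the quotient \<open>0 div 0 = 0\<close> is harmless.\<close>

lemma last_invariant_factor_right_multiple: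
  assumes M: "M \<in> carrier_mat n m" and "n \<le> m" and d: "last_invariant_factor M d"
  obtains N where "N \<in> carrier_mat m n" "M * N = d \<cdot>\<^sub>m 1\<^sub>m n"
proof -
  obtain U S V where n: "n > 0" and S: "S \<in> carrier_mat n m" "smith_form S"
    and U: "unimodular_mat n U" and V: "unimodular_mat m V" and MUSV: "M = U * S * V"
    and dS: "d = S $$ (n - 1, n - 1)"
    using M d \<open>n \<le> m\<close> by (auto simp: last_invariant_factor_def smith_decomposition_def Let_def)
  from unimodular_mat_inverse[OF U] obtain U' where U': "U' \<in> carrier_mat n n" "U * U' = 1\<^sub>m n" by blast
  from unimodular_mat_inverse[OF V] obtain V' where V': "V' \<in> carrier_mat m m" "V * V' = 1\<^sub>m m" by blast
  have Uc: "U \<in> carrier_mat n n" and Vc: "V \<in> carrier_mat m m"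
    using U V by (auto simp: unimodular_mat_def)
  define C where "C = mat m n (\<lambda>(i, j). if i = j then d div S $$ (i, i) else 0)"
  have C: "C \<in> carrier_mat m n" by (simp add: C_def)
  have "S * C = d \<cdot>\<^sub>m 1\<^sub>m n"
  proof (rule eq_matI)
    fix i j assume "i < dim_row (d \<cdot>\<^sub>m 1\<^sub>m n)" "j < dim_col (d \<cdot>\<^sub>m 1\<^sub>m n)"
    then have ij: "i < n" "j < n" by auto
    have diag: "S $$ (i, k) = 0" if "k < m" "k \<noteq> i" for k
      using S ij that by (auto simp: smith_form_def diagonal_mat_def)
    have "S $$ (i, i) dvd d"
      using smith_form_dvd[OF S(2), of "n - 1" i] S(1) ij n \<open>n \<le> m\<close> by (simp add: dS)
    have "(S * C) $$ (i, j) = (\<Sum>k\<in>{0..<m}. S $$ (i, k) * C $$ (k, j))"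
      using S(1) C ij by (auto simp: scalar_prod_def)
    also have "\<dots> = (\<Sum>k\<in>{0..<m}. if k = i then S $$ (i, i) * C $$ (i, j) else 0)"
      by (intro sum.cong) (auto simp: diag)
    also have "\<dots> = (d \<cdot>\<^sub>m 1\<^sub>m n) $$ (i, j)"
      using ij \<open>n \<le> m\<close> \<open>S $$ (i, i) dvd d\<close> by (cases "i = j") (simp_all add: C_def)
    finally show "(S * C) $$ (i, j) = (d \<cdot>\<^sub>m 1\<^sub>m n) $$ (i, j)" .
  qed (use S(1) in \<open>auto simp: C_def\<close>)
  \<comment> \<open>In \<open>V' * (C * U')\<close> the factor \<open>V'\<close> cancels
    \<open>V\<close>, then \<open>S * C\<close> contributes the scalar \<open>d\<close>, and
    \<open>U * U'\<close> is the identity.\<close>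
  have "M * (V' * (C * U')) = U * (S * ((V * V') * (C * U')))"
    unfolding MUSV using Uc S(1) Vc V'(1) C U'(1)
    by (simp add: assoc_mult_mat[of _ n n _ m _ m] assoc_mult_mat[of _ n n _ m _ n] assoc_mult_mat[of _ n m _ m _ n]
        assoc_mult_mat[of _ m m _ m _ n] mult_carrier_mat[of _ m n _ n] mult_carrier_mat[of _ m m _ n]
        mult_carrier_mat[of _ n m _ m] del: V'(2))
  also have "\<dots> = U * (S * (C * U'))" using C U'(1) by (simp add: V'(2))
  also have "S * (C * U') = d \<cdot>\<^sub>m U'"
    using assoc_mult_mat[OF S(1) C U'(1)] U'(1) \<open>S * C = d \<cdot>\<^sub>m 1\<^sub>m n\<close>
    by (simp add: mult_smult_assoc_mat[of _ n n _ n])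
  also have "U * (d \<cdot>\<^sub>m U') = d \<cdot>\<^sub>m 1\<^sub>m n"
    using Uc U' by (simp add: mult_smult_distrib[of _ n n _ n])
  finally show ?thesis
    using V'(1) C U'(1) by (intro that[of "V' * (C * U')"]) (auto intro!: mult_carrier_mat[of _ m m] mult_carrier_mat[of _ m n])
qed

text \<open>Multiply the hypothesis \<open>XM\<close> by \<open>N\<close> on the right. It is used
  both for a Gram determinant and for the last invariant factor in place of
  \<open>c\<close>.\<close>

lemma smult_eq_of_int_mat:
  fixes X :: "real mat" and M M' N :: "int mat"
  assumes X: "X \<in> carrier_mat n n" and M: "M \<in> carrier_mat n m" and M': "M' \<in> carrier_mat n m"
    and N: "N \<in> carrier_mat m n" and MN: "M * N = c \<cdot>\<^sub>m 1\<^sub>m n"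
    and XM: "X * map_mat real_of_int M = map_mat real_of_int M'"
  shows "real_of_int c \<cdot>\<^sub>m X = map_mat real_of_int (M' * N)"
proof -
  have "map_mat real_of_int (M' * N) = X * map_mat real_of_int M * map_mat real_of_int N"
    by (simp add: of_int_hom.mat_hom_mult[OF M' N] XM)
  also have "\<dots> = X * map_mat real_of_int (M * N)"
    using X M N by (simp add: of_int_hom.mat_hom_mult[OF M N] assoc_mult_mat[of _ n n _ m _ n])
  also have "map_mat real_of_int (M * N) = real_of_int c \<cdot>\<^sub>m 1\<^sub>m n"
    unfolding MN by (intro eq_matI) auto
  finally show ?thesis using X by (simp add: mult_smult_distrib[of _ n n _ n] right_mult_one_mat[of _ n n])
qed

section \<open>Walk matrices under change of ring and under intertwining maps\<close>

lemma ext_walk_mat_carrier: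
  "A \<in> carrier_mat n n \<Longrightarrow> ext_walk_mat A es \<in> carrier_mat n (length es * n)"
  by (auto simp: ext_walk_mat_def length_concat o_def sum_list_triv)

lemma map_mat_ext_walk_mat:
  assumes A: "A \<in> carrier_mat n n" and es: "set es \<subseteq> carrier_vec n"
  shows "map_mat real_of_int (ext_walk_mat A es)
    = ext_walk_mat (map_mat real_of_int A) (map (map_vec real_of_int) es)"
proof -
  have pow: "map_vec real_of_int (A ^\<^sub>m k *\<^sub>v e) = map_mat real_of_int A ^\<^sub>m k *\<^sub>v map_vec real_of_int e"
    if "e \<in> set es" for k e
    using that es A by (subst of_int_hom.mult_mat_vec_hom[of _ n n]) (auto simp: of_int_hom.mat_hom_pow)
  have c: "set [A ^\<^sub>m k *\<^sub>v e. e \<leftarrow> es, k \<leftarrow> [0..<n]] \<subseteq> carrier_vec n"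
    using A es by (auto intro!: mult_mat_vec_carrier[of _ n n])
  have "map (map_vec real_of_int) [A ^\<^sub>m k *\<^sub>v e. e \<leftarrow> es, k \<leftarrow> [0..<n]]
      = [map_mat real_of_int A ^\<^sub>m k *\<^sub>v e. e \<leftarrow> map (map_vec real_of_int) es, k \<leftarrow> [0..<n]]"
    by (auto simp: map_concat o_def pow intro!: arg_cong[of _ _ concat])
  with mat_of_cols_map[OF c, of real_of_int] A show ?thesis by (simp add: ext_walk_mat_def)
qed

lemma mult_ext_walk_mat:
  fixes A B X :: "'a::comm_semiring_1 mat"
  assumes A: "A \<in> carrier_mat n n" and B: "B \<in> carrier_mat n n" and X: "X \<in> carrier_mat n n"
    and comm: "X * A = B * X" and es: "\<And>e. e \<in> set es \<Longrightarrow> e \<in> carrier_vec n"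
    and fix_es: "\<And>e. e \<in> set es \<Longrightarrow> X *\<^sub>v e = e"
  shows "X * ext_walk_mat A es = ext_walk_mat B es"
proof -
  \<comment> \<open>The vector is kept arbitrary because the induction step applies the hypothesis
    to \<open>A *\<^sub>v v\<close>.\<close>
  have pow: "X *\<^sub>v (A ^\<^sub>m k *\<^sub>v v) = B ^\<^sub>m k *\<^sub>v (X *\<^sub>v v)" if "v \<in> carrier_vec n" for v k
    using that
  proof (induction k arbitrary: v)
    case 0
    then show ?case using A B X by simp
  next
    case (Suc k)
    then have "X *\<^sub>v (A ^\<^sub>m Suc k *\<^sub>v v) = B ^\<^sub>m k *\<^sub>v (X *\<^sub>v (A *\<^sub>v v))"
      using A by (simp add: assoc_mult_mat_vec[of _ n n _ n])
    also have "X *\<^sub>v (A *\<^sub>v v) = B *\<^sub>v (X *\<^sub>v v)"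
      using assoc_mult_mat_vec[OF X A Suc.prems] assoc_mult_mat_vec[OF B X Suc.prems] comm by simp
    finally show ?case using B X Suc.prems by (simp add: assoc_mult_mat_vec[of _ n n _ n])
  qed
  let ?w = "\<lambda>M. [M ^\<^sub>m k *\<^sub>v e. e \<leftarrow> es, k \<leftarrow> [0..<n]]"
  have wA: "set (?w A) \<subseteq> carrier_vec n" and wB: "set (?w B) \<subseteq> carrier_vec n"
    using A B es by (auto intro!: mult_mat_vec_carrier[of _ n n])
  have w: "map ((*\<^sub>v) X) (?w A) = ?w B"
    by (auto simp: map_concat o_def pow es fix_es intro!: arg_cong[of _ _ concat])
  have len: "length (?w A) = length (?w B)" by (metis w length_map)
  have "X * mat_of_cols n (?w A) = mat_of_cols n (?w B)"
  proof (rule mat_col_eqI)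
    fix j assume "j < dim_col (mat_of_cols n (?w B))"
    then have j: "j < length (?w B)" by simp
    have "?w A ! j \<in> carrier_vec n" "?w B ! j \<in> carrier_vec n"
      using wA wB j len by (metis nth_mem subsetD)+
    then have "col (X * mat_of_cols n (?w A)) j = X *\<^sub>v (?w A ! j)"
      using j len X by (subst col_mult2[of _ n n _ "length (?w A)"]) (auto simp del: length_concat)
    also have "\<dots> = ?w B ! j" using j len by (simp only: w[symmetric] nth_map)
    also have "\<dots> = col (mat_of_cols n (?w B)) j"
      using j \<open>?w B ! j \<in> carrier_vec n\<close> by (simp del: length_concat)
    finally show "col (X * mat_of_cols n (?w A)) j = col (mat_of_cols n (?w B)) j" .
  qed (use X len in \<open>simp_all del: length_concat\<close>)
  then show ?thesis using A B by (simp add: ext_walk_mat_def)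
qed

section \<open>Adjacency matrices and characteristic vectors over the integers and the reals\<close>

lemma transpose_adjacency_mat:
  assumes "pair_graph G"
  shows "transpose_mat (adjacency_mat vs G) = adjacency_mat vs G"
proof -
  interpret pair_graph G by fact
  show ?thesis by (rule eq_matI) (auto simp: adjacency_mat_def intro: arcs_symmetric)
qed

lemma adjacency_mat_carrier [simp]: "adjacency_mat vs G \<in> carrier_mat (length vs) (length vs)"
  by (simp add: adjacency_mat_def)

lemma char_vec_carrier [simp]: "char_vec vs S \<in> carrier_vec (length vs)"
  by (simp add: char_vec_def)

lemma map_mat_adjacency_mat: "map_mat real_of_int (adjacency_mat vs G) = adjacency_mat vs G"
  by (rule eq_matI) (auto simp: adjacency_mat_def)

lemma map_vec_char_vec: "map_vec real_of_int (char_vec vs S) = char_vec vs S"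
  by (rule eq_vecI) (auto simp: char_vec_def)

text \<open>Invariant factors require the integral walk matrix, while \<open>Q\<close> acts on the
  real one; this identifies the two.\<close>

lemma map_mat_walk_mat:
  "map_mat real_of_int (ext_walk_mat (adjacency_mat vs G) (map (char_vec vs) Vs))
    = ext_walk_mat (adjacency_mat vs G) (map (char_vec vs) Vs)"
  by (subst map_mat_ext_walk_mat[of _ "length vs"]) (auto simp: map_mat_adjacency_mat map_vec_char_vec o_def)

theorem theorem1p3:
  fixes G H :: "'v pair_pre_digraph"
    and vs :: "'v list"         \<comment> \<open>the vertex set \<open>V\<close>, enumerated\<close>
    and Vs :: "'v set list"     \<comment> \<open>the degree classes \<open>V_1, \<dots>, V_p\<close>\<close>
    and n :: nat
    and A B :: "real mat" and es :: "real vec list"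
    and W :: "int mat" and is_Q :: "real mat \<Rightarrow> bool"
  defines "A \<equiv> adjacency_mat vs G"
    and "B \<equiv> adjacency_mat vs H"
    and "es \<equiv> map (char_vec vs) Vs"
    and "W \<equiv> ext_walk_mat (adjacency_mat vs G) (map (char_vec vs) Vs)"
    and "is_Q \<equiv> (\<lambda>Q. orthonormal_mat n Q \<and> transpose_mat Q * A * Q = B
                    \<and> (\<forall>e \<in> set es. transpose_mat Q *\<^sub>v e = e))"
  assumes G: "pair_graph G" and H: "pair_graph H"
    and vs: "distinct vs" "pverts G = set vs" "pverts H = set vs" "length vs = n"
    and deg: "\<And>v. v \<in> set vs \<Longrightarrow> out_degree G v = out_degree H v"
    and Vs: "distinct Vs" "set Vs = degree_classes G"
    and gbls: "gbls_equiv es A B"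
  shows "(\<exists>Q. is_Q Q)
    \<and> (full_row_rank (map_mat real_of_int W) \<longrightarrow>
         (\<exists>!Q. is_Q Q) \<and> (\<forall>Q. is_Q Q \<longrightarrow> elements_mat Q \<subseteq> \<rat>))
    \<and> (\<forall>Q d. is_Q Q \<longrightarrow> last_invariant_factor W d \<longrightarrow>
         elements_mat (real_of_int d \<cdot>\<^sub>m Q) \<subseteq> \<int>)"
proof -
  have A: "A \<in> carrier_mat n n" and B: "B \<in> carrier_mat n n"
    using vs(4) by (auto simp: A_def B_def)
  have es: "e \<in> carrier_vec n" if "e \<in> set es" for e using that vs(4) by (auto simp: es_def)
  define m where "m = length Vs * n"
  \<comment> \<open>The walk matrix of \<open>H\<close> is built from the same classes
    \<open>Vs\<close>, whose characteristic vectors are fixed by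
    \<open>transpose_mat Q\<close>.\<close>
  define W' :: "int mat" where "W' = ext_walk_mat (adjacency_mat vs H) (map (char_vec vs) Vs)"
  have W: "W \<in> carrier_mat n m" and W': "W' \<in> carrier_mat n m"
    using ext_walk_mat_carrier[OF adjacency_mat_carrier, of vs _ "map (char_vec vs) Vs"] vs(4)
    by (simp_all add: W_def W'_def m_def)
  have ex: "\<exists>Q. is_Q Q"
    unfolding is_Q_def using gbls_equiv_imp_orthonormal_mat[OF A _ B _ _ gbls] es
    by (auto simp: A_def B_def transpose_adjacency_mat[OF G] transpose_adjacency_mat[OF H])
  have QW: "transpose_mat Q * map_mat real_of_int W = map_mat real_of_int W'" if "is_Q Q" for Q
  proof -
    have Q: "orthonormal_mat n Q" and QAQ: "transpose_mat Q * A * Q = B"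
      and Qe: "\<And>e. e \<in> set es \<Longrightarrow> transpose_mat Q *\<^sub>v e = e"
      using that by (auto simp: is_Q_def)
    have Qc: "Q \<in> carrier_mat n n" using Q by (rule orthonormal_mat_carrier)
    \<comment> \<open>Cancelling \<open>Q * transpose_mat Q\<close> turns the similarity into the
      intertwining relation required by \<open>mult_ext_walk_mat\<close>.\<close>
    have "transpose_mat Q * A * (Q * transpose_mat Q) = transpose_mat Q * A * Q * transpose_mat Q"
      using Qc A by (simp add: assoc_mult_mat[of _ n n _ n _ n])
    then have "transpose_mat Q * A = B * transpose_mat Q"
      using Q Qc A unfolding QAQ by (simp add: orthonormal_mat_def right_mult_one_mat[of _ n n])
    from mult_ext_walk_mat[where es = es, OF A B _ this es Qe] Qc
    show ?thesis by (simp add: W_def W'_def map_mat_walk_mat A_def B_def es_def)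
  qed
  \<comment> \<open>The right-hand side is integral and does not mention \<open>Q\<close>: the first
    property gives integrality, the second gives uniqueness when \<open>c\<close> is
    nonzero.\<close>
  have scaled: "real_of_int c \<cdot>\<^sub>m Q = map_mat real_of_int (transpose_mat (W' * N))"
    if Q: "is_Q Q" and N: "N \<in> carrier_mat m n" "W * N = c \<cdot>\<^sub>m 1\<^sub>m n" for Q N c
  proof -
    have "transpose_mat Q \<in> carrier_mat n n" using Q by (auto simp: is_Q_def orthonormal_mat_def)
    from smult_eq_of_int_mat[OF this W W' N QW[OF Q]]
    have "transpose_mat (real_of_int c \<cdot>\<^sub>m transpose_mat Q) = transpose_mat (map_mat real_of_int (W' * N))"
      by simp
    moreover have "transpose_mat (real_of_int c \<cdot>\<^sub>m transpose_mat Q) = real_of_int c \<cdot>\<^sub>m Q"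
      by (rule eq_matI) auto
    ultimately show ?thesis by (simp add: map_mat_transpose)
  qed
  have full: "(\<exists>!Q. is_Q Q) \<and> (\<forall>Q. is_Q Q \<longrightarrow> elements_mat Q \<subseteq> \<rat>)"
    if rank: "full_row_rank (map_mat real_of_int W)"
  proof -
    let ?K = "W * transpose_mat W"
    \<comment> \<open>With this choice \<open>W * ?N\<close> is the Gram matrix times its adjugate,
      that is, its determinant times the identity.\<close>
    let ?N = "transpose_mat W * adj_mat ?K" and ?c = "real_of_int (det ?K)"
    have K: "?K \<in> carrier_mat n n" using W by (auto intro!: mult_carrier_mat[of _ n m])
    have "map_mat real_of_int ?K = map_mat real_of_int W * transpose_mat (map_mat real_of_int W)"
      using W by (simp add: of_int_hom.mat_hom_mult[of _ n m _ n] map_mat_transpose)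
    then have "det (map_mat real_of_int ?K) \<noteq> 0"
      using full_row_rank_imp_gram_nonsingular[OF _ rank, of n m] W by simp
    then have c: "?c \<noteq> 0" by simp
    have N: "?N \<in> carrier_mat m n" using W adj_mat(1)[OF K] by (auto intro!: mult_carrier_mat[of _ m n])
    have "W * ?N = det ?K \<cdot>\<^sub>m 1\<^sub>m n"
      using assoc_mult_mat[of W n m "transpose_mat W" n "adj_mat ?K" n] adj_mat(1,2)[OF K] W
      by (simp only: transpose_carrier_mat)
    note eq = scaled[OF _ N this]
    \<comment> \<open>Each entry is a quotient of integers independent of \<open>Q\<close>, which
      settles both uniqueness and rationality.\<close>
    have entry: "Q $$ (i, j) = real_of_int ((W' * ?N) $$ (j, i)) / ?c"
      if "is_Q Q" "i < n" "j < n" for Q i j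
    proof -
      have "Q \<in> carrier_mat n n" using that by (simp add: is_Q_def orthonormal_mat_def)
      then show ?thesis using arg_cong[OF eq[OF that(1)], of "\<lambda>M. M $$ (i, j)"] that(2,3) c W'
          adj_mat(1)[OF K]
        by (simp add: field_simps)
    qed
    have car: "Q \<in> carrier_mat n n" if "is_Q Q" for Q using that by (simp add: is_Q_def orthonormal_mat_def)
    have "Q = R" if "is_Q Q" "is_Q R" for Q R
      using car[OF that(1)] car[OF that(2)] by (intro eq_matI) (auto simp: entry that)
    moreover have "elements_mat Q \<subseteq> \<rat>" if "is_Q Q" for Q
      using car[OF that] by (auto simp: elements_mat_def entry[OF that])
    ultimately show ?thesis using ex by blast
  qed
  have int: "elements_mat (real_of_int d \<cdot>\<^sub>m Q) \<subseteq> \<int>" if Q: "is_Q Q" and d: "last_invariant_factor W d" for Q d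
  proof -
    \<comment> \<open>An invariant factor exists only for a nonempty matrix, so there is at least
      one class and \<open>W\<close> has at least \<open>n\<close> columns.\<close>
    have "0 < min n m" using d W by (auto simp: last_invariant_factor_def Let_def)
    then have "n \<le> m" by (cases Vs) (auto simp: m_def)
    then obtain N where "N \<in> carrier_mat m n" "W * N = d \<cdot>\<^sub>m 1\<^sub>m n"
      using last_invariant_factor_right_multiple[OF W _ d] by blast
    from scaled[OF Q this] show ?thesis by (auto simp: elements_mat_def)
  qed
  show ?thesis using ex full int by blast
qed

end
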